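(* For every $\epsilon>\frac13$ there is a constant $C>0$ such that for all $f\in L^{4/3}(\mathbb{H},(1-\log|z_2|)^{\epsilon})$ and all $\lambda>0$, $$\left|\{(z_1,z_2)\in\mathbb{H} : |P(f)(z_1,z_2)|>\lambda\}\right| \le \frac{C\,\|f\|^{4/3}_{L^{4/3}(\mathbb{H},(1-\log|z_2|)^{\epsilon})}}{\lambda^{4/3}}.$$
   Context: $\mathbb{H}=\{(z_1,z_2)\in\mathbb{C}^2:|z_1|<|z_2|<1\}$, $dV$ Lebesgue measure, $|U|$ Lebesgue measure of $U$. The Bergman projection is $P(f)(z)=\int_{\mathbb{H}}K_{\mathbb{H}}(z;\bar w)f(w)\,dV(w)$, $K_{\mathbb{H}}(z_1,z_2;\bar w_1,\bar w_2)=\frac{1}{\pi^2 z_2\bar w_2(1-\frac{z_1\bar w_1}{z_2\bar w_2})^2(1-z_2\bar w_2)^2}$. For a positive weight $\mu$, $\|f\|^p_{L^p(\mathbb{H},\mu)}=\int_{\mathbb{H}}|f|^p\mu\,dV$. *)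

theory Defs
  imports "HOL-Analysis.Analysis"
begin

definition hartogs :: "(complex \<times> complex) set" where
  "hartogs = {(z1, z2). cmod z1 < cmod z2 \<and> cmod z2 < 1}"

definition bergman_kernel :: "complex \<times> complex \<Rightarrow> complex \<times> complex \<Rightarrow> complex" where
  "bergman_kernel z w =
     1 / (complex_of_real (pi ^ 2) * snd z * cnj (snd w)
          * (1 - (fst z * cnj (fst w)) / (snd z * cnj (snd w))) ^ 2
          * (1 - snd z * cnj (snd w)) ^ 2)"

definition bergman_proj :: "(complex \<times> complex \<Rightarrow> complex) \<Rightarrow> complex \<times> complex \<Rightarrow> complex" where
  "bergman_proj f z = (LINT w | lebesgue_on hartogs. bergman_kernel z w * f w)"

definition hweight :: "real \<Rightarrow> complex \<times> complex \<Rightarrow> real" where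
  "hweight eps w = (1 - ln (cmod (snd w))) powr eps"

definition wLp_pow :: "real \<Rightarrow> (complex \<times> complex \<Rightarrow> real) \<Rightarrow> (complex \<times> complex \<Rightarrow> complex) \<Rightarrow> ennreal" where
  "wLp_pow p \<mu> f = (\<integral>\<^sup>+ w. ennreal (cmod (f w) powr p * \<mu> w) \<partial>(lebesgue_on hartogs))"

definition in_wLp :: "real \<Rightarrow> (complex \<times> complex \<Rightarrow> real) \<Rightarrow> (complex \<times> complex \<Rightarrow> complex) \<Rightarrow> bool" where
  "in_wLp p \<mu> f \<longleftrightarrow> f \<in> borel_measurable (lebesgue_on hartogs) \<and> wLp_pow p \<mu> f < \<infinity>"

end

theory Submission
  imports Defs
begin

text \<open>
  In the coordinates \<open>z\<^sub>1 = t z\<^sub>2\<close> the kernel of the Hartogs triangle is a product of two disc kernels, and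
  each of these, with absolute values, maps \<open>(1 - |s|\<^sup>2)\<^bsup>-a\<^esup>\<close> to a multiple of itself for
  \<open>0 < a < 1\<close>. The only obstruction at the endpoint 4/3 is the singularity at \<open>z\<^sub>2 = 0\<close>, and the
  logarithmic weight removes it because \<open>|y|\<^bsup>-2\<^esup> (1 - ln |y|)\<^bsup>-3\<epsilon>\<^esup>\<close> is integrable over the disc
  exactly when \<open>\<epsilon> > 1/3\<close>. A Schur test with the density \<open>|w\<^sub>2|\<^bsup>-3\<^esup> (1 - ln |w\<^sub>2|)\<^bsup>-3\<epsilon>\<^esup>\<close>
  times powers of the disc defining functions then bounds the positive operator with kernel \<open>|K|\<close>.
\<close>

section \<open>Lebesgue measure on the complex plane\<close>

text \<open>The density is forced by the dual Schur condition. Write L = 1 - ln|w_2| and p = 4/3, so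
  p - 1 = 1/3. Integrating |K| in one variable leaves a factor 1/|w_2| in the other, so phi^(1/3)
  times the weight L^eps has to be comparable to 1/|w_2|, apart from the powers of the disc defining
  functions. Solving for phi gives |w_2|^(-3) L^(-3 eps). In the direct condition the kernel
  supplies 1/|y| and the change of coordinates the Jacobian |y|^2, so |y|^(-3) becomes |y|^(-2).
  This is the critical power in the plane: without the logarithm the integral diverges at 0. What
  comes out is only of size 1/|z_2|, much smaller than phi near z_2 = 0, so the Schur test has to
  allow different test functions on the two sides.\<close>

lemma borel_measurable_indicator_ball [measurable, simp]:
  "(indicator (ball x r) :: 'a::metric_space \<Rightarrow> ennreal) \<in> borel_measurable borel"
  by (auto intro: borel_measurable_indicator)

lemma borel_measurable_cnj [measurable]: "cnj \<in> borel_measurable borel"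
  by (intro borel_measurable_continuous_onI continuous_intros)

lemma nn_integral_lborel_translate:
  fixes f :: "'a::euclidean_space \<Rightarrow> ennreal"
  assumes [measurable]: "f \<in> borel_measurable borel"
  shows "(\<integral>\<^sup>+x. f (t + x) \<partial>lborel) = (\<integral>\<^sup>+x. f x \<partial>lborel)"
proof -
  have "(\<integral>\<^sup>+x. f x \<partial>lborel) = (\<integral>\<^sup>+x. f x \<partial>distr lborel borel ((+) t))"
    by (simp only: lborel_distr_plus)
  also have "\<dots> = (\<integral>\<^sup>+x. f (t + x) \<partial>lborel)"
    by (subst nn_integral_distr) auto
  finally show ?thesis by simp
qed

lemma emeasure_lborel_ball_complex:
  assumes "r \<ge> 0"
  shows "emeasure lborel (ball (a::complex) r) = ennreal (pi * r\<^sup>2)"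
  using emeasure_ball[OF assms, of a] by (simp add: unit_ball_vol_2)

lemma emeasure_lborel_cball_complex:
  assumes "r \<ge> 0"
  shows "emeasure lborel (cball (a::complex) r) = ennreal (pi * r\<^sup>2)"
  using emeasure_cball[OF assms, of a] by (simp add: unit_ball_vol_2)

text \<open>Uniqueness of Haar measure, made explicit: integrating \<open>1\<^bsub>B\<^esub>(x) f(c y + x)\<close> over \<open>x\<close> and
  \<open>y\<close> in both orders, with \<open>B\<close> the unit disc, produces the modulus of multiplication by \<open>c\<close>
  without computing a determinant.\<close>

lemma nn_integral_lborel_complex_mult:
  fixes f :: "complex \<Rightarrow> ennreal"
  assumes f[measurable]: "f \<in> borel_measurable borel" and c: "c \<noteq> 0"
  shows "(\<integral>\<^sup>+y. f (c * y) \<partial>lborel) = ennreal (1 / (cmod c)\<^sup>2) * (\<integral>\<^sup>+x. f x \<partial>lborel)"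
proof -
  let ?B = "ball (0::complex) 1"
  let ?i = "indicator ?B :: complex \<Rightarrow> ennreal"
  have "ennreal pi * (\<integral>\<^sup>+y. f (c * y) \<partial>lborel) = (\<integral>\<^sup>+x. ?i x * (\<integral>\<^sup>+y. f (c * y) \<partial>lborel) \<partial>lborel)"
    by (subst nn_integral_multc) (auto simp: emeasure_lborel_ball_complex)
  also have "\<dots> = (\<integral>\<^sup>+x. (\<integral>\<^sup>+y. ?i x * f (c * y + x) \<partial>lborel) \<partial>lborel)"
  proof (rule nn_integral_cong)
    fix x :: complex
    have "(\<integral>\<^sup>+y. f (c * y) \<partial>lborel) = (\<integral>\<^sup>+y. f (c * (x / c + y)) \<partial>lborel)"
      by (rule nn_integral_lborel_translate[symmetric]) simp
    also have "\<dots> = (\<integral>\<^sup>+y. f (c * y + x) \<partial>lborel)"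
      using c by (simp add: distrib_left add.commute)
    finally show "?i x * (\<integral>\<^sup>+y. f (c * y) \<partial>lborel) = (\<integral>\<^sup>+y. ?i x * f (c * y + x) \<partial>lborel)"
      by (simp add: nn_integral_cmult)
  qed
  also have "\<dots> = (\<integral>\<^sup>+y. (\<integral>\<^sup>+x. ?i x * f (c * y + x) \<partial>lborel) \<partial>lborel)"
    by (rule lborel_pair.Fubini') simp
  also have "\<dots> = (\<integral>\<^sup>+y. (\<integral>\<^sup>+x. ?i (x - c * y) * f x \<partial>lborel) \<partial>lborel)"
  proof (rule nn_integral_cong)
    fix y :: complex
    have "(\<integral>\<^sup>+x. ?i (c * y + x - c * y) * f (c * y + x) \<partial>lborel) = (\<integral>\<^sup>+x. ?i (x - c * y) * f x \<partial>lborel)"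
      by (rule nn_integral_lborel_translate) simp
    then show "(\<integral>\<^sup>+x. ?i x * f (c * y + x) \<partial>lborel) = (\<integral>\<^sup>+x. ?i (x - c * y) * f x \<partial>lborel)"
      by simp
  qed
  also have "\<dots> = (\<integral>\<^sup>+x. (\<integral>\<^sup>+y. ?i (x - c * y) * f x \<partial>lborel) \<partial>lborel)"
    by (rule lborel_pair.Fubini') simp
  also have "\<dots> = (\<integral>\<^sup>+x. ennreal (pi * (1 / cmod c)\<^sup>2) * f x \<partial>lborel)"
  proof (rule nn_integral_cong)
    fix x :: complex
    \<comment> \<open>For fixed \<open>x\<close>, the \<open>y\<close> with |x - c y| < 1 form the
      disc of radius 1/|c| about x/c. Its area is where the factor 1/|c|^2 comes from.\<close>
    have "?i (x - c * y) = indicator (ball (x / c) (1 / cmod c)) y" for y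
    proof -
      have "x - c * y = c * (x / c - y)"
        using c by (simp add: algebra_simps)
      then have "cmod (x - c * y) = cmod c * cmod (x / c - y)"
        by (metis norm_mult)
      then show ?thesis
        using c norm_minus_commute[of x "c * y"] unfolding indicator_def mem_ball dist_0_norm dist_complex_def
        by (simp add: pos_less_divide_eq mult.commute)
    qed
    then show "(\<integral>\<^sup>+y. ?i (x - c * y) * f x \<partial>lborel) = ennreal (pi * (1 / cmod c)\<^sup>2) * f x"
      by (subst nn_integral_multc) (simp_all add: emeasure_lborel_ball_complex borel_measurable_indicator)
  qed
  also have "\<dots> = ennreal pi * (ennreal (1 / (cmod c)\<^sup>2) * (\<integral>\<^sup>+x. f x \<partial>lborel))"
    by (subst nn_integral_cmult) (auto simp: ennreal_mult power_divide mult.assoc simp flip: times_divide_eq_right)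
  finally have "ennreal pi * (\<integral>\<^sup>+y. f (c * y) \<partial>lborel)
      = ennreal pi * (ennreal (1 / (cmod c)\<^sup>2) * (\<integral>\<^sup>+x. f x \<partial>lborel))" .
  then show ?thesis
    by (simp add: ennreal_mult_cancel_left)
qed

text \<open>The image of area measure on the disc under |s|^2 is pi times length on [0,1], because
  the annulus x < |s|^2 < 1 has area pi (1 - x). Finite measures on the line that agree on all open
  upper half-lines coincide, so areas of discs replace polar coordinates.\<close>

lemma nn_integral_unit_disc_radial:
  fixes F :: "real \<Rightarrow> ennreal"
  assumes [measurable]: "F \<in> borel_measurable borel"
  shows "(\<integral>\<^sup>+s. F ((cmod s)\<^sup>2) * indicator (ball 0 1) s \<partial>lborel)
    = ennreal pi * (\<integral>\<^sup>+x. F x * indicator {0..1} x \<partial>lborel)"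
proof -
  let ?M = "distr (density lborel (indicator (ball (0::complex) 1))) borel (\<lambda>s. (cmod s)\<^sup>2)"
  let ?N = "density lborel (\<lambda>x. ennreal pi * indicator {0..1::real} x)"
  have M: "emeasure ?M {x<..} = emeasure lborel (ball (0::complex) 1 \<inter> {s. x < (cmod s)\<^sup>2})" for x
  proof -
    have [measurable]: "{s::complex. x < (cmod s)\<^sup>2} \<in> sets borel"
      by measurable
    have "emeasure ?M {x<..} = emeasure (density lborel (indicator (ball (0::complex) 1))) {s. x < (cmod s)\<^sup>2}"
      by (subst emeasure_distr) (auto simp: vimage_def)
    also have "\<dots> = (\<integral>\<^sup>+s. indicator (ball (0::complex) 1) s * indicator {s. x < (cmod s)\<^sup>2} s \<partial>lborel)"
      by (rule emeasure_density) (auto intro: borel_measurable_indicator)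
    also have "\<dots> = (\<integral>\<^sup>+s. indicator (ball (0::complex) 1 \<inter> {s. x < (cmod s)\<^sup>2}) s \<partial>lborel)"
      by (simp only: indicator_inter_arith)
    also have "\<dots> = emeasure lborel (ball (0::complex) 1 \<inter> {s. x < (cmod s)\<^sup>2})"
      by (rule nn_integral_indicator) simp
    finally show ?thesis .
  qed
  have N: "emeasure ?N {x<..} = ennreal pi * emeasure lborel ({0..1} \<inter> {x<..})" for x
    by (subst nn_integral_indicator[symmetric])
       (auto simp: emeasure_density mult.assoc nn_integral_cmult[symmetric]
          simp del: nn_integral_indicator intro!: nn_integral_cong split: split_indicator)
  have ball: "emeasure lborel (ball (0::complex) 1) = ennreal pi"
    by (simp add: emeasure_lborel_ball_complex)
  have "?M = ?N"
  proof (rule measure_eqI_lessThan)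
    fix x :: real
    have "emeasure ?M {x<..} \<le> emeasure lborel (ball (0::complex) 1)"
      unfolding M by (intro emeasure_mono) auto
    then show "emeasure ?M {x<..} < \<infinity>"
      by (simp add: ball order_le_less_trans)
    consider "x < 0" | "0 \<le> x" "x < 1" | "1 \<le> x" by linarith
    then show "emeasure ?M {x<..} = emeasure ?N {x<..}"
    proof cases
      case 1
      then have "ball (0::complex) 1 \<inter> {s. x < (cmod s)\<^sup>2} = ball 0 1" "{0..1} \<inter> {x<..} = {0..1}"
        by (auto intro: less_le_trans[of x 0])
      then show ?thesis by (simp only: M N ball) simp
    next
      case 2
      have iff: "x < (cmod s)\<^sup>2 \<longleftrightarrow> sqrt x < cmod s" for s
        using real_sqrt_less_iff[of x "(cmod s)\<^sup>2"] by (simp del: real_sqrt_less_iff)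
      have eq: "ball (0::complex) 1 \<inter> {s. x < (cmod s)\<^sup>2} = ball 0 1 - cball 0 (sqrt x)"
        by (simp add: set_eq_iff iff not_le)
      have "sqrt x < 1" using 2 by simp
      then have "cmod s < 1" if "cmod s \<le> sqrt x" for s
        using that by linarith
      then have "cball (0::complex) (sqrt x) \<subseteq> ball 0 1"
        by auto
      then have "emeasure ?M {x<..} = ennreal pi - ennreal (pi * x)"
        using 2 unfolding M eq
        by (subst emeasure_Diff) (auto simp: emeasure_lborel_cball_complex ball)
      also have "\<dots> = ennreal (pi * (1 - x))"
        using 2 by (simp add: ennreal_minus right_diff_distrib)
      also have "\<dots> = emeasure ?N {x<..}"
      proof -
        have "{0..1} \<inter> {x<..} = {x<..1}" using 2 by auto
        then show ?thesis using 2 by (simp add: N ennreal_mult)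
      qed
      finally show ?thesis .
    next
      case 3
      have "\<not> x < (cmod s)\<^sup>2" if "cmod s < 1" for s
        using 3 that power_le_one[of "cmod s" 2] by simp
      then have "ball (0::complex) 1 \<inter> {s. x < (cmod s)\<^sup>2} = {}" "{0..1} \<inter> {x<..} = {}"
        using 3 by auto
      then show ?thesis by (simp only: M N) simp
    qed
  qed simp_all
  then have "(\<integral>\<^sup>+x. F x \<partial>?M) = (\<integral>\<^sup>+x. F x \<partial>?N)" by simp
  then show ?thesis
    by (simp add: nn_integral_distr nn_integral_density mult.assoc nn_integral_cmult)
       (simp add: mult.commute nn_integral_cmult)
qed

section \<open>Disc kernels\<close>

text \<open>Up to the factor 1 - |u|^2 the integrand is the Poisson kernel, with the explicit
  antiderivative \<theta> - 2 arg(1 - u e^(i \<theta>)). Since 1 - u e^(i \<theta>) stays in the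
  right half-plane, the principal logarithm is smooth along the circle and returns to its initial
  value; only the linear term contributes, namely 2 pi.\<close>

lemma nn_integral_poisson_kernel:
  fixes u :: complex
  assumes u: "cmod u < 1"
  shows "(\<integral>\<^sup>+\<theta>. ennreal (1 / (cmod (1 - u * cis \<theta>))\<^sup>2) * indicator {0..2*pi} \<theta> \<partial>lborel)
    = ennreal (2 * pi / (1 - (cmod u)\<^sup>2))"
proof -
  have u2: "1 - (cmod u)\<^sup>2 > 0"
    using u by (simp add: abs_square_less_1)
  define F where "F = (\<lambda>\<theta>. (\<theta> - 2 * Im (Ln (1 - u * cis \<theta>))) / (1 - (cmod u)\<^sup>2))"
  have pos: "Re (1 - u * cis \<theta>) > 0" for \<theta>
  proof -
    have "Re (u * cis \<theta>) \<le> cmod u"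
      using complex_Re_le_cmod[of "u * cis \<theta>"] by (simp add: norm_mult)
    then show ?thesis using u by simp
  qed
  have der: "(F has_real_derivative 1 / (cmod (1 - u * cis \<theta>))\<^sup>2) (at \<theta>)" for \<theta>
  proof -
    define v where "v = u * cis \<theta>"
    have v: "Re (1 - v) > 0" "cmod v = cmod u"
      using pos[of \<theta>] by (auto simp: v_def norm_mult)
    then have v0: "1 - v \<noteq> 0"
      by (metis zero_complex.sel(1) less_irrefl)
    from v have nr: "1 - v \<notin> \<real>\<^sub>\<le>\<^sub>0"
      by (auto simp: complex_nonpos_Reals_iff)
    have cis: "(cis has_vector_derivative \<i> * cis \<theta>) (at \<theta>)"
      using has_derivative_cis[OF has_derivative_ident, of \<theta> UNIV] by (simp add: has_vector_derivative_def)
    have "((\<lambda>\<theta>. 1 - u * cis \<theta>) has_vector_derivative - (u * (\<i> * cis \<theta>))) (at \<theta>)"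
      by (auto intro!: derivative_eq_intros cis)
    moreover have "(Ln has_field_derivative inverse (1 - v)) (at (1 - u * cis \<theta>))"
      using has_field_derivative_Ln[OF nr] by (simp add: v_def)
    ultimately have "((\<lambda>\<theta>. Ln (1 - u * cis \<theta>)) has_vector_derivative
        - (u * (\<i> * cis \<theta>)) * inverse (1 - v)) (at \<theta>)"
      by (rule field_vector_diff_chain_at[unfolded o_def])
    then have "((\<lambda>\<theta>. Im (Ln (1 - u * cis \<theta>))) has_vector_derivative
        Im (- (u * (\<i> * cis \<theta>)) * inverse (1 - v))) (at \<theta>)"
      by (rule bounded_linear.has_vector_derivative[OF bounded_linear_Im])
    then have "((\<lambda>\<theta>. Im (Ln (1 - u * cis \<theta>))) has_real_derivative
        Im (- \<i> * (v / (1 - v)))) (at \<theta>)"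
      by (simp add: has_real_derivative_iff_has_vector_derivative v_def field_simps)
    then have "(F has_real_derivative
        (1 - 2 * Im (- \<i> * (v / (1 - v)))) / (1 - (cmod u)\<^sup>2)) (at \<theta>)"
      unfolding F_def by (intro DERIV_cdivide DERIV_diff DERIV_cmult DERIV_ident)
    \<comment> \<open>The left side is 1 + 2 Re(v/(1 - v)) = Re((1 + v)/(1 - v)), the usual form of
      the Poisson kernel.\<close>
    moreover have "1 - 2 * Im (- \<i> * (v / (1 - v))) = (1 - (cmod u)\<^sup>2) / (cmod (1 - v))\<^sup>2"
    proof -
      have "(cmod (1 - v))\<^sup>2 \<noteq> 0" using v0 by simp
      moreover have "Im (- \<i> * (v / (1 - v))) = - Re (v / (1 - v))"
        using Im_i_times[of "v / (1 - v)"] by (simp only: mult_minus_left uminus_complex.sel)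
      moreover have "Re (v / (1 - v)) = (Re v * (1 - Re v) - (Im v)\<^sup>2) / (cmod (1 - v))\<^sup>2"
        unfolding Re_divide cmod_power2 by (simp add: power2_eq_square)
      ultimately have "(1 - 2 * Im (- \<i> * (v / (1 - v)))) * (cmod (1 - v))\<^sup>2 = (cmod (1 - v))\<^sup>2 + 2 * Re v * (1 - Re v) - 2 * (Im v)\<^sup>2"
        by (simp add: field_simps)
      also have "\<dots> = 1 - (cmod v)\<^sup>2"
        unfolding cmod_power2 by (simp add: power2_eq_square algebra_simps)
      finally show ?thesis using \<open>(cmod (1 - v))\<^sup>2 \<noteq> 0\<close> v(2) by (simp add: field_simps)
    qed
    ultimately show ?thesis using u2 by (simp add: v_def)
  qed
  have "(\<integral>\<^sup>+\<theta>. ennreal (1 / (cmod (1 - u * cis \<theta>))\<^sup>2) * indicator {0..2*pi} \<theta> \<partial>lborel) = ennreal (F (2*pi) - F 0)"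
  proof (rule nn_integral_FTC_Icc)
    have "(\<lambda>\<theta>. cmod (1 - u * cis \<theta>)) \<in> borel_measurable borel"
      by (intro borel_measurable_continuous_onI continuous_intros)
    then show "(\<lambda>\<theta>. 1 / (cmod (1 - u * cis \<theta>))\<^sup>2) \<in> borel_measurable borel"
      by measurable
  qed (auto intro: der)
  also have "F (2*pi) - F 0 = 2 * pi / (1 - (cmod u)\<^sup>2)"
    by (simp add: F_def diff_divide_distrib)
  finally show ?thesis .
qed

text \<open>Averaging over rotations replaces the kernel by the mean of the Poisson kernel.\<close>

lemma nn_integral_disc_kernel_radial:
  fixes F :: "real \<Rightarrow> ennreal"
  assumes [measurable]: "F \<in> borel_measurable borel" and t: "cmod t < 1"
  shows "(\<integral>\<^sup>+s. F ((cmod s)\<^sup>2) * ennreal (1 / (cmod (1 - t * cnj s))\<^sup>2) * indicator (ball 0 1) s \<partial>lborel)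
    = ennreal pi * (\<integral>\<^sup>+x. F x * ennreal (1 / (1 - (cmod t)\<^sup>2 * x)) * indicator {0..1} x \<partial>lborel)"
    (is "?I = _")
proof -
  let ?D = "indicator (ball 0 1) :: complex \<Rightarrow> ennreal"
  have [measurable]: "cis \<in> borel_measurable borel"
    by (intro borel_measurable_continuous_onI continuous_intros)
  have "ennreal (2 * pi) * ?I = (\<integral>\<^sup>+\<theta>. ?I * indicator {0..2*pi} \<theta> \<partial>lborel)"
    by (subst nn_integral_cmult) (auto simp: mult.commute)
  also have "\<dots> = (\<integral>\<^sup>+\<theta>. (\<integral>\<^sup>+s. F ((cmod s)\<^sup>2) * ennreal (1 / (cmod (1 - t * cnj s * cis \<theta>))\<^sup>2)
      * ?D s * indicator {0..2*pi} \<theta> \<partial>lborel) \<partial>lborel)"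
  proof (rule nn_integral_cong)
    fix \<theta> :: real
    \<comment> \<open>The rotation by -\<theta> has modulus 1 and preserves both |s| and the disc,
      so it changes only the kernel, where conjugation turns it into \<open>cis \<theta>\<close>.
      Hence \<open>?I\<close> equals each rotated integral and may be averaged over
      \<theta>.\<close>
    let ?f = "\<lambda>s. F ((cmod s)\<^sup>2) * ennreal (1 / (cmod (1 - t * cnj s))\<^sup>2) * ?D s"
    have "(\<integral>\<^sup>+s. ?f (cis (-\<theta>) * s) \<partial>lborel) = ?I"
      by (subst nn_integral_lborel_complex_mult) simp_all
    moreover have "?f (cis (-\<theta>) * s)
        = F ((cmod s)\<^sup>2) * ennreal (1 / (cmod (1 - t * cnj s * cis \<theta>))\<^sup>2) * ?D s" for s
      by (simp add: norm_mult indicator_def cis_cnj mult_ac)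
    ultimately have "?I = (\<integral>\<^sup>+s. F ((cmod s)\<^sup>2) * ennreal (1 / (cmod (1 - t * cnj s * cis \<theta>))\<^sup>2) * ?D s \<partial>lborel)"
      by simp
    then show "?I * indicator {0..2*pi} \<theta> = (\<integral>\<^sup>+s. F ((cmod s)\<^sup>2)
        * ennreal (1 / (cmod (1 - t * cnj s * cis \<theta>))\<^sup>2) * ?D s * indicator {0..2*pi} \<theta> \<partial>lborel)"
      by (simp add: nn_integral_multc)
  qed
  also have "\<dots> = (\<integral>\<^sup>+s. (\<integral>\<^sup>+\<theta>. F ((cmod s)\<^sup>2) * ennreal (1 / (cmod (1 - t * cnj s * cis \<theta>))\<^sup>2)
      * ?D s * indicator {0..2*pi} \<theta> \<partial>lborel) \<partial>lborel)"
    by (rule lborel_pair.Fubini') measurable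
  also have "\<dots> = (\<integral>\<^sup>+s. ennreal (2 * pi) * (F ((cmod s)\<^sup>2) * ennreal (1 / (1 - (cmod t)\<^sup>2 * (cmod s)\<^sup>2)) * ?D s) \<partial>lborel)"
  proof (rule nn_integral_cong)
    fix s :: complex
    let ?p = "\<lambda>\<theta>. ennreal (1 / (cmod (1 - t * cnj s * cis \<theta>))\<^sup>2) * indicator {0..2*pi} \<theta>"
    have "(\<integral>\<^sup>+\<theta>. F ((cmod s)\<^sup>2) * ennreal (1 / (cmod (1 - t * cnj s * cis \<theta>))\<^sup>2) * ?D s * indicator {0..2*pi} \<theta> \<partial>lborel)
      = (\<integral>\<^sup>+\<theta>. (F ((cmod s)\<^sup>2) * ?D s) * ?p \<theta> \<partial>lborel)"
      by (simp add: mult_ac)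
    also have "\<dots> = F ((cmod s)\<^sup>2) * ?D s * (\<integral>\<^sup>+\<theta>. ?p \<theta> \<partial>lborel)"
      by (rule nn_integral_cmult) simp
    also have "\<dots> = ennreal (2 * pi) * (F ((cmod s)\<^sup>2) * ennreal (1 / (1 - (cmod t)\<^sup>2 * (cmod s)\<^sup>2)) * ?D s)"
    proof (cases "cmod s < 1")
      case True
      then have ts: "cmod (t * cnj s) < 1"
        using t mult_strict_mono[of "cmod t" 1 "cmod s" 1] by (simp add: norm_mult)
      have "(\<integral>\<^sup>+\<theta>. ?p \<theta> \<partial>lborel) = ennreal (2 * pi / (1 - (cmod (t * cnj s))\<^sup>2))"
        by (rule nn_integral_poisson_kernel[OF ts])
      also have "\<dots> = ennreal (2 * pi) * ennreal (1 / (1 - (cmod t)\<^sup>2 * (cmod s)\<^sup>2))"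
        by (subst ennreal_mult'[symmetric]) (simp_all add: norm_mult power_mult_distrib)
      finally show ?thesis by (simp add: mult_ac)
    qed simp
    finally show "(\<integral>\<^sup>+\<theta>. F ((cmod s)\<^sup>2) * ennreal (1 / (cmod (1 - t * cnj s * cis \<theta>))\<^sup>2)
        * ?D s * indicator {0..2*pi} \<theta> \<partial>lborel)
      = ennreal (2 * pi) * (F ((cmod s)\<^sup>2) * ennreal (1 / (1 - (cmod t)\<^sup>2 * (cmod s)\<^sup>2)) * ?D s)" .
  qed
  also have "\<dots> = ennreal (2 * pi) * (\<integral>\<^sup>+s. F ((cmod s)\<^sup>2) * ennreal (1 / (1 - (cmod t)\<^sup>2 * (cmod s)\<^sup>2)) * ?D s \<partial>lborel)"
    by (rule nn_integral_cmult) simp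
  finally have "?I = (\<integral>\<^sup>+s. F ((cmod s)\<^sup>2) * ennreal (1 / (1 - (cmod t)\<^sup>2 * (cmod s)\<^sup>2)) * ?D s \<partial>lborel)"
    by (simp add: ennreal_mult_cancel_left)
  also have "\<dots> = ennreal pi * (\<integral>\<^sup>+x. F x * ennreal (1 / (1 - (cmod t)\<^sup>2 * x)) * indicator {0..1} x \<partial>lborel)"
    by (rule nn_integral_unit_disc_radial) simp
  finally show ?thesis .
qed

text \<open>With y = 1 - x and \<delta> = 1 - r the denominator is at least both \<delta> and y.
  Below y = \<delta> the first bound leaves y^(-a), integrable at 0 since a < 1; above it the second
  leaves y^(-a-1), integrable at infinity since a > 0. Both pieces are multiples of \<delta>^(-a),
  with factors 1/(1 - a) and 1/a.\<close>

lemma nn_integral_radial_kernel_le: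
  fixes a r :: real
  assumes a: "0 < a" "a < 1" and r: "0 \<le> r" "r < 1"
  shows "(\<integral>\<^sup>+x. ennreal ((1 - x) powr (-a)) * ennreal (1 / (1 - r * x)) * indicator {0..1} x \<partial>lborel)
    \<le> ennreal ((1 / a + 1 / (1 - a)) * (1 - r) powr (-a))"
proof -
  define \<delta> where "\<delta> = 1 - r"
  have \<delta>: "0 < \<delta>" "\<delta> \<le> 1" using r by (auto simp: \<delta>_def)
  let ?g = "\<lambda>y. ennreal (y powr (-a)) * indicator {0..\<delta>} y"
  let ?h = "\<lambda>y. ennreal (y powr (-a-1)) * indicator {\<delta>..} y"
  have "(\<integral>\<^sup>+x. ennreal ((1 - x) powr (-a)) * ennreal (1 / (1 - r * x)) * indicator {0..1} x \<partial>lborel)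
    = (\<integral>\<^sup>+y. ennreal (y powr (-a)) * ennreal (1 / (1 - r * (1 - y))) * indicator {0..1} (1 - y) \<partial>lborel)"
    by (subst nn_integral_real_affine[where c = "-1" and t = 1]) simp_all
  also have "\<dots> \<le> (\<integral>\<^sup>+y. ennreal (1 / \<delta>) * ?g y + ?h y \<partial>lborel)"
  proof (rule nn_integral_mono)
    fix y :: real
    show "ennreal (y powr (-a)) * ennreal (1 / (1 - r * (1 - y))) * indicator {0..1} (1 - y)
      \<le> ennreal (1 / \<delta>) * ?g y + ?h y"
    proof (cases "0 \<le> y \<and> y \<le> 1")
      case True
      \<comment> \<open>Each form displays one of the two lower bounds plus a nonnegative
        remainder.\<close>
      have eq: "1 - r * (1 - y) = \<delta> + r * y" "1 - r * (1 - y) = y + \<delta> * (1 - y)"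
        by (auto simp: \<delta>_def algebra_simps)
      have ge: "\<delta> \<le> 1 - r * (1 - y)" "y \<le> 1 - r * (1 - y)"
        using True r \<delta> by (simp add: eq(1), subst eq(2), simp)
      show ?thesis
      proof (cases "y \<le> \<delta>")
        case yd: True
        have "y powr (-a) * (1 / (1 - r * (1 - y))) \<le> y powr (-a) * (1 / \<delta>)"
          using ge \<delta> by (intro mult_left_mono divide_left_mono mult_pos_pos) auto
        then have "ennreal (y powr (-a)) * ennreal (1 / (1 - r * (1 - y))) \<le> ennreal (1 / \<delta>) * ennreal (y powr (-a))"
          using \<delta> by (simp add: ennreal_mult'[symmetric] mult.commute flip: times_divide_eq_right)
        then show ?thesis
          using True yd by (auto intro: add_increasing2)
      next
        case False
        then have y: "y > 0" using \<delta> by simp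
        have "y powr (-a) * (1 / (1 - r * (1 - y))) \<le> y powr (-a) * (1 / y)"
          using ge y by (intro mult_left_mono divide_left_mono mult_pos_pos) auto
        also have "\<dots> = y powr (-a-1)"
          using y by (simp add: powr_diff)
        finally have "ennreal (y powr (-a)) * ennreal (1 / (1 - r * (1 - y))) \<le> ennreal (y powr (-a-1))"
          by (simp add: ennreal_mult'[symmetric] flip: times_divide_eq_right)
        then show ?thesis
          using True False by auto
      qed
    qed auto
  qed
  also have "\<dots> = ennreal (1 / \<delta>) * (\<integral>\<^sup>+y. ?g y \<partial>lborel) + (\<integral>\<^sup>+y. ?h y \<partial>lborel)"
    by (subst nn_integral_add) (simp_all add: nn_integral_cmult)
  also have "(\<integral>\<^sup>+y. ?g y \<partial>lborel) = ennreal (\<delta> powr (-a + 1) / (-a + 1))"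
    using a \<delta> by (intro nn_integral_has_integral_lebesgue' has_integral_powr_from_0) auto
  also have "(\<integral>\<^sup>+y. ?h y \<partial>lborel) = ennreal (- (\<delta> powr (-a - 1 + 1)) / (-a - 1 + 1))"
    using a \<delta> by (intro nn_integral_has_integral_lebesgue' has_integral_powr_to_inf) auto
  also have "ennreal (1 / \<delta>) * ennreal (\<delta> powr (-a + 1) / (-a + 1)) + ennreal (- (\<delta> powr (-a - 1 + 1)) / (-a - 1 + 1))
    = ennreal (1 / \<delta> * (\<delta> powr (-a + 1) / (-a + 1)) + \<delta> powr (-a) / a)"
    using a \<delta> by (simp add: ennreal_mult'[symmetric] del: times_divide_eq_left times_divide_eq_right)
  also have "1 / \<delta> * (\<delta> powr (-a + 1) / (-a + 1)) + \<delta> powr (-a) / a = (1 / a + 1 / (1 - a)) * \<delta> powr (-a)"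
  proof -
    have "1 / \<delta> * (\<delta> * V / (-a + 1)) + V / a = (1 / a + 1 / (1 - a)) * V" for V
      using a \<delta> by (simp add: field_simps)
    moreover have "\<delta> powr (-a + 1) = \<delta> * \<delta> powr (-a)"
      using \<delta> by (simp only: powr_add) simp
    ultimately show ?thesis by metis
  qed
  finally show ?thesis
    by (simp add: \<delta>_def)
qed

lemma nn_integral_disc_kernel_powr_le:
  assumes a: "0 < a" "a < 1" and t: "cmod t < 1"
  shows "(\<integral>\<^sup>+s. ennreal ((1 - (cmod s)\<^sup>2) powr (-a) / (cmod (1 - t * cnj s))\<^sup>2) * indicator (ball 0 1) s \<partial>lborel)
    \<le> ennreal (pi * (1 / a + 1 / (1 - a)) * (1 - (cmod t)\<^sup>2) powr (-a))"
proof -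
  have "(\<integral>\<^sup>+s. ennreal ((1 - (cmod s)\<^sup>2) powr (-a) / (cmod (1 - t * cnj s))\<^sup>2) * indicator (ball 0 1) s \<partial>lborel)
    = (\<integral>\<^sup>+s. ennreal ((1 - (cmod s)\<^sup>2) powr (-a)) * ennreal (1 / (cmod (1 - t * cnj s))\<^sup>2) * indicator (ball 0 1) s \<partial>lborel)"
    by (simp add: ennreal_mult'[symmetric])
  also have "\<dots> = ennreal pi * (\<integral>\<^sup>+x. ennreal ((1 - x) powr (-a)) * ennreal (1 / (1 - (cmod t)\<^sup>2 * x)) * indicator {0..1} x \<partial>lborel)"
    by (rule nn_integral_disc_kernel_radial[OF _ t]) simp
  also have "\<dots> \<le> ennreal pi * ennreal ((1 / a + 1 / (1 - a)) * (1 - (cmod t)\<^sup>2) powr (-a))"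
    using a t by (intro mult_left_mono nn_integral_radial_kernel_le) (auto simp: abs_square_less_1)
  finally show ?thesis
    using a by (simp add: ennreal_mult'[symmetric] mult.assoc)
qed

section \<open>The logarithmic singularity at the origin\<close>

text \<open>Here x stands for |w|^2, so ln x / 2 is ln|w|: this is the radial form of the integral
  of |w|^(-2) (1 - ln|w|)^(-d). The antiderivative is a multiple of (1 - ln x / 2)^(1 - d), which
  tends to 0 at the origin because d > 1. With d = 3 eps this is where eps > 1/3 is
  decisive.\<close>

lemma has_integral_inverse_log_powr:
  fixes d :: real
  assumes d: "d > 1"
  shows "((\<lambda>x. 1 / x * (1 - ln x / 2) powr (-d)) has_integral 2 / (d - 1)) {0..1}"
proof -
  define G where "G = (\<lambda>x. 2 / (d - 1) * (1 - ln x / 2) powr (1 - d) :: real)"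
  \<comment> \<open>The antiderivative extended by its limit at 0, since \<open>ln 0 = 0\<close> gives \<open>G 0\<close> a junk value.\<close>
  define G' where "G' = (\<lambda>x. if x \<le> 0 then 0 else G x)"
  have G: "(G has_real_derivative 1 / x * (1 - ln x / 2) powr (-d)) (at x)" if "0 < x" "x < 1" for x
  proof -
    have pos: "1 - ln x / 2 > 0" using that ln_less_zero[of x] by linarith
    have "((\<lambda>x. 1 - ln x / 2) has_real_derivative (0 - 1 / x / 2)) (at x)"
      using that by (intro DERIV_diff DERIV_const DERIV_cdivide DERIV_ln_divide)
    from DERIV_cmult[OF DERIV_fun_powr[OF this pos, of "1 - d"], of "2 / (d - 1)"]
    have "(G has_real_derivative
        2 / (d - 1) * ((1 - d) * (1 - ln x / 2) powr (-d) * (0 - 1 / x / 2))) (at x)"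
      by (simp add: G_def)
    moreover have "2 / (d - 1) * ((1 - d) * V * (0 - 1 / x / 2)) = 1 / x * V" for V
      using that d by (simp add: field_simps)
    ultimately show ?thesis by simp
  qed
  have ev: "\<forall>\<^sub>F y in nhds x. G y = G' y" if "0 < x" for x
    using eventually_nhds_in_open[of "{0<..}" x] that by (auto elim!: eventually_mono simp: G'_def)
  have G'd: "(G' has_real_derivative 1 / x * (1 - ln x / 2) powr (-d)) (at x)" if "0 < x" "x < 1" for x
    using G[OF that] DERIV_cong_ev[OF refl ev[OF that(1)] refl] by simp
  have "filterlim (\<lambda>x::real. 1 + (- ln x) * (1 / 2)) at_top (at_right 0)"
    by (intro filterlim_tendsto_add_at_top[OF tendsto_const]
          filterlim_at_top_mult_tendsto_pos[OF tendsto_const]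
          filterlim_compose[OF filterlim_uminus_at_top_at_bot] ln_at_0) simp
  then have "((\<lambda>x. (1 - ln x / 2) powr (1 - d)) \<longlongrightarrow> 0) (at_right (0::real))"
    using d by (intro tendsto_neg_powr) simp_all
  from tendsto_mult[OF tendsto_const this, of "2 / (d - 1)"] have "(G \<longlongrightarrow> 0) (at_right 0)"
    by (simp add: G_def)
  then have lim0: "(G' \<longlongrightarrow> 0) (at_right 0)"
    by (rule Lim_transform_eventually) (auto simp: eventually_at_filter G'_def)
  have "isCont G 1"
    unfolding G_def using d by (intro continuous_intros) auto
  then have "isCont G' 1"
    using isCont_cong[OF ev[of 1]] by simp
  then have lim1: "(G' \<longlongrightarrow> G' 1) (at_left 1)"
    by (simp add: isCont_def filterlim_at_split)
  have "((\<lambda>x. 1 / x * (1 - ln x / 2) powr (-d)) has_integral (G' 1 - G' 0)) {0..1}"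
  \<comment> \<open>The integrand is singular at 0, so differentiability is supplied only inside the
    interval, together with continuity up to the endpoints.\<close>
  proof (rule fundamental_theorem_of_calculus_interior)
    show "continuous_on {0..1} G'"
    proof (rule continuous_on_IccI)
      fix x :: real assume "0 < x" "x < 1"
      then show "(G' \<longlongrightarrow> G' x) (at x)"
        using DERIV_isCont[OF G'd] by (simp add: isCont_def)
    qed (use lim0 lim1 in \<open>auto simp: G'_def\<close>)
  qed (use G'd in \<open>auto simp: has_real_derivative_iff_has_vector_derivative\<close>)
  then show ?thesis
    by (simp add: G'_def G_def)
qed

text \<open>The singularity at the origin and those at the boundary are separated by the circle |w|
  = 1/2. Inside, the boundary power is at most 2 and the kernel at most 4, leaving 8 times the
  logarithmic integral. Outside, |w|^(-2) is at most 4 and the logarithmic factor at most 1, leaving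
  4 times the pure power estimate.\<close>

lemma nn_integral_disc_kernel_log_le:
  assumes d: "d > 1" and b: "0 < b" "b < 1" and z: "cmod z < 1"
  shows "(\<integral>\<^sup>+w. ennreal (1 / (cmod w)\<^sup>2 * (1 - ln (cmod w)) powr (-d) * (1 - (cmod w)\<^sup>2) powr (-b)
      / (cmod (1 - z * cnj w))\<^sup>2) * indicator (ball 0 1) w \<partial>lborel)
    \<le> ennreal ((4 * (pi * (1 / b + 1 / (1 - b))) + 8 * (pi * (2 / (d - 1)))) * (1 - (cmod z)\<^sup>2) powr (-b))"
    (is "?I \<le> _")
proof -
  let ?P = "(1 - (cmod z)\<^sup>2) powr (-b)"
  let ?c = "pi * (1 / b + 1 / (1 - b))"
  let ?e = "pi * (2 / (d - 1))"
  let ?A = "\<lambda>w. ennreal ((1 - (cmod w)\<^sup>2) powr (-b) / (cmod (1 - z * cnj w))\<^sup>2) * indicator (ball 0 1) w"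
  let ?L = "\<lambda>x. ennreal (1 / x * (1 - ln x / 2) powr (-d))"
  let ?B = "\<lambda>w. ?L ((cmod w)\<^sup>2) * indicator (ball 0 1) w"
  have z2: "0 < 1 - (cmod z)\<^sup>2" "1 - (cmod z)\<^sup>2 \<le> 1"
    using z by (auto simp: abs_square_less_1)
  have P1: "1 \<le> ?P"
    using z2 b powr_mono2'[of "-b" "1 - (cmod z)\<^sup>2" 1] by simp
  have "?I \<le> (\<integral>\<^sup>+w. ennreal 4 * ?A w + ennreal 8 * ?B w \<partial>lborel)"
  proof (rule nn_integral_mono)
    fix w :: complex
    let ?k = "1 / (cmod w)\<^sup>2 * (1 - ln (cmod w)) powr (-d)"
    let ?q = "(1 - (cmod w)\<^sup>2) powr (-b)"
    let ?n = "(cmod (1 - z * cnj w))\<^sup>2"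
    show "ennreal (?k * ?q / ?n) * indicator (ball 0 1) w \<le> ennreal 4 * ?A w + ennreal 8 * ?B w"
    \<comment> \<open>At \<open>w = 0\<close> the left side vanishes by the convention 1/0 = 0, and
      off the disc the indicator vanishes.\<close>
    proof (cases "cmod w < 1 \<and> w \<noteq> 0")
      case True
      then have w: "0 < cmod w" "cmod w < 1" by auto
      have lg: "1 - ln (cmod w) \<ge> 1" using w ln_less_zero[of "cmod w"] by linarith
      have powr_le: "(1 - ln (cmod w)) powr (-d) \<le> 1"
        using lg d powr_mono2'[of "-d" 1 "1 - ln (cmod w)"] by simp
      show ?thesis
      proof (cases "cmod w < 1/2")
        case small: True
        have "(cmod w)\<^sup>2 \<le> (1/2)\<^sup>2" using small by (intro power_mono) auto
        then have w2: "3/4 \<le> 1 - (cmod w)\<^sup>2" by (simp add: power2_eq_square)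
        have "?q \<le> (3/4) powr (-b)"
          using w2 b by (intro powr_mono2') auto
        also have "\<dots> \<le> (3/4) powr (-1)"
          using b by (intro powr_mono') auto
        also have "\<dots> \<le> 2" by (simp add: powr_minus_divide)
        finally have q: "?q \<le> 2" .
        have "cmod (z * cnj w) \<le> 1 * (1/2)"
          unfolding norm_mult using z small by (intro mult_mono) auto
        then have "1/2 \<le> cmod (1 - z * cnj w)"
          using norm_triangle_ineq2[of 1 "z * cnj w"] by simp
        then have "(1/2)\<^sup>2 \<le> ?n" by (intro power_mono) auto
        then have n: "1 / ?n \<le> 4" by (simp add: divide_simps power2_eq_square split: if_splits)
        have "?k * ?q / ?n = ?k * (?q * (1 / ?n))" by simp
        also have "\<dots> \<le> ?k * (2 * 4)"
          using q n by (intro mult_left_mono mult_mono) auto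
        finally have "ennreal (?k * ?q / ?n) \<le> ennreal (8 * ?k)"
          by (intro ennreal_leI) (simp add: mult.commute)
        also have "\<dots> = ennreal 8 * ?B w"
          using w by (subst ennreal_mult) (auto simp: ln_realpow)
        finally show ?thesis using w by (auto intro: add_increasing)
      next
        case False
        then have "(1/2)\<^sup>2 \<le> (cmod w)\<^sup>2" by (intro power_mono) auto
        then have "1 / (cmod w)\<^sup>2 \<le> 4" using w by (simp add: divide_simps power2_eq_square split: if_splits)
        then have "?k \<le> 4 * 1"
          using powr_le by (intro mult_mono) auto
        then have "?k * (?q / ?n) \<le> 4 * (?q / ?n)"
          by (intro mult_right_mono) auto
        then have "ennreal (?k * ?q / ?n) \<le> ennreal (4 * (?q / ?n))"
          by (intro ennreal_leI) (simp only: times_divide_eq_right)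
        also have "\<dots> = ennreal 4 * ennreal (?q / ?n)"
          by (rule ennreal_mult') simp
        finally have "ennreal (?k * ?q / ?n) \<le> ennreal 4 * ?A w"
          using w by simp
        then show ?thesis using w by (auto intro: add_increasing2)
      qed
    qed auto
  qed
  also have "\<dots> = ennreal 4 * (\<integral>\<^sup>+w. ?A w \<partial>lborel) + ennreal 8 * (\<integral>\<^sup>+w. ?B w \<partial>lborel)"
    by (subst nn_integral_add) (simp_all add: nn_integral_cmult)
  also have "(\<integral>\<^sup>+w. ?B w \<partial>lborel) = ennreal pi * (\<integral>\<^sup>+x. ?L x * indicator {0..1} x \<partial>lborel)"
    by (rule nn_integral_unit_disc_radial) simp
  also have "(\<integral>\<^sup>+x. ?L x * indicator {0..1} x \<partial>lborel) = ennreal (2 / (d - 1))"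
    by (rule nn_integral_has_integral_lebesgue'[OF _ has_integral_inverse_log_powr[OF d]]) auto
  also have "ennreal 4 * (\<integral>\<^sup>+w. ?A w \<partial>lborel) + ennreal 8 * (ennreal pi * ennreal (2 / (d - 1)))
     \<le> ennreal 4 * ennreal (?c * ?P) + ennreal 8 * (ennreal pi * ennreal (2 / (d - 1)))"
    by (intro add_right_mono mult_left_mono nn_integral_disc_kernel_powr_le b z) simp
  also have "\<dots> = ennreal (4 * (?c * ?P) + 8 * ?e)"
    using b d by (simp add: ennreal_mult'[symmetric] del: ennreal_numeral times_divide_eq_left times_divide_eq_right)
  also have "\<dots> \<le> ennreal ((4 * ?c + 8 * ?e) * ?P)"
  \<comment> \<open>The inner contribution does not depend on z; it is absorbed because
    \<open>?P\<close>, a negative power of a number in (0,1], is at least 1.\<close>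
  proof (rule ennreal_leI)
    have "8 * ?e * 1 \<le> 8 * ?e * ?P"
      using P1 d by (intro mult_left_mono) auto
    then show "4 * (?c * ?P) + 8 * ?e \<le> (4 * ?c + 8 * ?e) * ?P"
      by (simp only: distrib_right mult.assoc)
  qed
  finally show ?thesis .
qed

section \<open>A weak-type Schur test\<close>

text \<open>If g exceeds \<phi>/A then A g/\<phi> is at least 1, and multiplying g by its (p - 1)-st
  power yields the first summand; otherwise the second summand already dominates.\<close>

lemma le_schur_split:
  fixes A g \<phi> p :: real
  assumes "A > 0" "\<phi> > 0" "g \<ge> 0" "p > 1"
  shows "g \<le> A powr (p - 1) * (g powr p * \<phi> powr (1 - p)) + \<phi> / A"
proof (cases "g \<le> \<phi> / A")
  case True
  then show ?thesis by (simp add: add_increasing)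
next
  case False
  then have g: "g > 0" and "1 \<le> A * g / \<phi>"
    using assms by (auto simp: field_simps intro: less_le_trans[of 0 "\<phi> / A"])
  then have "1 \<le> (A * g / \<phi>) powr (p - 1)"
    using assms by (intro ge_one_powr_ge_zero) auto
  then have "g * 1 \<le> g * (A * g / \<phi>) powr (p - 1)"
    using g by (intro mult_left_mono) auto
  also have "\<dots> = g * (A powr (p - 1) * g powr (p - 1) * \<phi> powr (1 - p))"
    using assms g powr_minus_divide[of \<phi> "p - 1"] by (simp add: powr_mult powr_divide)
  also have "\<dots> = A powr (p - 1) * (g powr p * \<phi> powr (1 - p))"
    using g powr_add[of g 1 "p - 1"] by simp
  finally show ?thesis
    using assms by (simp add: add_increasing2)
qed

text \<open>Splitting \<open>g\<close> at the level \<open>\<phi> / A\<close>, with \<open>A = 2 C\<^sub>1 \<Psi>(z) / \<lambda>\<close>, makes the small part contribute at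
  most \<open>\<lambda>/2\<close>; the large part is treated by Markov's inequality. Unlike the strong-type Schur test this
  needs neither Hoelder's inequality nor powers of the integral operator.\<close>

lemma weak_type_schur_test:
  fixes k :: "'a \<Rightarrow> 'b \<Rightarrow> ennreal" and \<phi> \<sigma> g :: "'b \<Rightarrow> real" and \<Psi> :: "'a \<Rightarrow> real"
  assumes "sigma_finite_measure M" "sigma_finite_measure N"
    and [measurable]: "case_prod k \<in> borel_measurable (M \<Otimes>\<^sub>M N)" "\<phi> \<in> borel_measurable N"
      "\<Psi> \<in> borel_measurable M" "\<sigma> \<in> borel_measurable N" "g \<in> borel_measurable N"
    and p: "p > 1" and C: "C\<^sub>1 > 0" "C\<^sub>2 \<ge> 0" and lam: "lam > 0"
    and \<phi>: "\<And>w. w \<in> space N \<Longrightarrow> \<phi> w > 0"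
    and \<Psi>: "\<And>z. z \<in> space M \<Longrightarrow> \<Psi> z > 0"
    and g: "\<And>w. w \<in> space N \<Longrightarrow> g w \<ge> 0"
    and S1: "\<And>z. z \<in> space M \<Longrightarrow> (\<integral>\<^sup>+w. k z w * ennreal (\<phi> w) \<partial>N) \<le> ennreal (C\<^sub>1 * \<Psi> z)"
    and S2: "\<And>w. w \<in> space N \<Longrightarrow>
      (\<integral>\<^sup>+z. k z w * ennreal (\<Psi> z powr (p - 1)) \<partial>M) \<le> ennreal (C\<^sub>2 * (\<phi> w powr (p - 1) * \<sigma> w))"
  shows "emeasure M {z \<in> space M. ennreal lam < (\<integral>\<^sup>+w. k z w * ennreal (g w) \<partial>N)}
    \<le> ennreal (2 powr p * C\<^sub>1 powr (p - 1) * C\<^sub>2 / lam powr p) * (\<integral>\<^sup>+w. ennreal (g w powr p * \<sigma> w) \<partial>N)"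
proof -
  interpret M: sigma_finite_measure M by fact
  interpret N: sigma_finite_measure N by fact
  interpret MN: pair_sigma_finite M N ..
  let ?G = "\<lambda>w. ennreal (g w powr p * \<phi> w powr (1 - p))"
  define U where "U = (\<lambda>z. \<integral>\<^sup>+w. k z w * ?G w \<partial>N)"
  define c where "c = 2 powr p * C\<^sub>1 powr (p - 1) / lam powr p"
  have c0: "c \<ge> 0" by (simp add: c_def)
  have [measurable]: "U \<in> borel_measurable M"
    unfolding U_def by measurable
  \<comment> \<open>The estimate lam/2 <= A^(p-1) U is rescaled to level 1, the form required by
    Markov's inequality. As A is proportional to \<open>\<Psi> z\<close>, the dependence on z
    becomes the factor \<Psi>^(p-1) that the second Schur hypothesis integrates.\<close>
  have large: "1 \<le> ennreal c * (ennreal (\<Psi> z powr (p - 1)) * U z)"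
    if z: "z \<in> space M" and big: "ennreal lam < (\<integral>\<^sup>+w. k z w * ennreal (g w) \<partial>N)" for z
  proof -
    have [measurable]: "k z \<in> borel_measurable N"
      using z by measurable
    define A where "A = 2 * C\<^sub>1 * \<Psi> z / lam"
    have A: "A > 0" using C lam \<Psi>[OF z] by (simp add: A_def)
    have "(\<integral>\<^sup>+w. k z w * ennreal (g w) \<partial>N)
      \<le> (\<integral>\<^sup>+w. ennreal (A powr (p - 1)) * (k z w * ?G w) + ennreal (1 / A) * (k z w * ennreal (\<phi> w)) \<partial>N)"
    proof (rule nn_integral_mono)
      fix w assume w: "w \<in> space N"
      have "ennreal (g w) \<le> ennreal (A powr (p - 1) * (g w powr p * \<phi> w powr (1 - p)) + \<phi> w / A)"
        using A \<phi>[OF w] g[OF w] p by (intro ennreal_leI le_schur_split)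
      also have "\<dots> = ennreal (A powr (p - 1)) * ?G w + ennreal (1 / A) * ennreal (\<phi> w)"
        using A \<phi>[OF w] by (simp add: ennreal_mult'[symmetric] ennreal_plus[symmetric] del: ennreal_plus)
      finally show "k z w * ennreal (g w)
          \<le> ennreal (A powr (p - 1)) * (k z w * ?G w) + ennreal (1 / A) * (k z w * ennreal (\<phi> w))"
        by (metis (no_types, lifting) distrib_left mult.left_commute mult_left_mono zero_le)
    qed
    also have "\<dots> = ennreal (A powr (p - 1)) * U z + ennreal (1 / A) * (\<integral>\<^sup>+w. k z w * ennreal (\<phi> w) \<partial>N)"
      by (subst nn_integral_add) (simp_all add: nn_integral_cmult U_def)
    also have "\<dots> \<le> ennreal (A powr (p - 1)) * U z + ennreal (1 / A) * ennreal (C\<^sub>1 * \<Psi> z)"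
      by (intro add_left_mono mult_left_mono S1 z) simp
    also have "ennreal (1 / A) * ennreal (C\<^sub>1 * \<Psi> z) = ennreal (lam / 2)"
      using A C lam \<Psi>[OF z] by (subst ennreal_mult'[symmetric]) (auto simp: A_def)
    finally have *: "ennreal lam < ennreal (A powr (p - 1)) * U z + ennreal (lam / 2)"
      using big by simp
    \<comment> \<open>\<open>U z\<close> may be infinite, so lam/2 is cancelled by contradiction
      rather than by subtraction.\<close>
    have "ennreal (lam / 2) \<le> ennreal (A powr (p - 1)) * U z"
    proof (rule ccontr)
      assume "\<not> ?thesis"
      then have "ennreal (A powr (p - 1)) * U z + ennreal (lam / 2) \<le> ennreal (lam / 2) + ennreal (lam / 2)"
        by (intro add_right_mono) simp
      also have "\<dots> = ennreal lam"
        using lam by (simp flip: ennreal_plus)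
      finally show False using * by simp
    qed
    then have "ennreal (2 / lam) * ennreal (lam / 2) \<le> ennreal (2 / lam) * (ennreal (A powr (p - 1)) * U z)"
      by (intro mult_left_mono) simp_all
    also have "ennreal (2 / lam) * ennreal (lam / 2) = 1"
      using lam by (simp add: ennreal_mult'[symmetric])
    also have "ennreal (2 / lam) * (ennreal (A powr (p - 1)) * U z) = ennreal (2 / lam * A powr (p - 1)) * U z"
      using lam by (subst ennreal_mult') (simp_all add: mult.assoc del: times_divide_eq_left)
    also have "2 / lam * A powr (p - 1) = c * \<Psi> z powr (p - 1)"
    proof -
      have "2 / lam * A powr (p - 1)
          = (2 * 2 powr (p - 1)) * C\<^sub>1 powr (p - 1) * \<Psi> z powr (p - 1) / (lam * lam powr (p - 1))"
        using C lam \<Psi>[OF z] by (simp add: A_def powr_mult powr_divide)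
      also have "2 * 2 powr (p - 1) = 2 powr p"
        using powr_add[of 2 1 "p - 1"] by simp
      also have "lam * lam powr (p - 1) = lam powr p"
        using lam powr_add[of lam 1 "p - 1"] by simp
      finally show ?thesis by (simp add: c_def)
    qed
    finally show ?thesis
      using c0 by (simp add: ennreal_mult mult.assoc)
  qed
  have "emeasure M {z \<in> space M. ennreal lam < (\<integral>\<^sup>+w. k z w * ennreal (g w) \<partial>N)}
    \<le> emeasure M {z \<in> space M. 1 \<le> ennreal c * (ennreal (\<Psi> z powr (p - 1)) * U z)}"
    using large by (intro emeasure_mono) auto
  also have "\<dots> \<le> ennreal c * (\<integral>\<^sup>+z. ennreal (\<Psi> z powr (p - 1)) * U z * indicator (space M) z \<partial>M)"
    by (rule nn_integral_Markov_inequality) auto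
  also have "(\<integral>\<^sup>+z. ennreal (\<Psi> z powr (p - 1)) * U z * indicator (space M) z \<partial>M)
    = (\<integral>\<^sup>+z. (\<integral>\<^sup>+w. ennreal (\<Psi> z powr (p - 1)) * (k z w * ?G w) \<partial>N) \<partial>M)"
    by (rule nn_integral_cong) (simp add: U_def nn_integral_cmult)
  also have "\<dots> = (\<integral>\<^sup>+w. (\<integral>\<^sup>+z. ennreal (\<Psi> z powr (p - 1)) * (k z w * ?G w) \<partial>M) \<partial>N)"
    by (rule MN.Fubini'[symmetric]) measurable
  also have "\<dots> \<le> (\<integral>\<^sup>+w. ennreal C\<^sub>2 * ennreal (g w powr p * \<sigma> w) \<partial>N)"
  proof (rule nn_integral_mono)
    fix w assume w: "w \<in> space N"
    have [measurable]: "(\<lambda>z. k z w) \<in> borel_measurable M"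
      using w by measurable
    have "(\<integral>\<^sup>+z. ennreal (\<Psi> z powr (p - 1)) * (k z w * ?G w) \<partial>M)
      = (\<integral>\<^sup>+z. ?G w * (k z w * ennreal (\<Psi> z powr (p - 1))) \<partial>M)"
      by (simp add: mult_ac)
    also have "\<dots> = ?G w * (\<integral>\<^sup>+z. k z w * ennreal (\<Psi> z powr (p - 1)) \<partial>M)"
      by (rule nn_integral_cmult) simp
    also have "\<dots> \<le> ?G w * ennreal (C\<^sub>2 * (\<phi> w powr (p - 1) * \<sigma> w))"
      by (intro mult_left_mono S2 w) simp
    also have "\<dots> = ennreal (g w powr p * \<phi> w powr (1 - p) * (C\<^sub>2 * (\<phi> w powr (p - 1) * \<sigma> w)))"
      by (rule ennreal_mult'[symmetric]) simp
    also have "g w powr p * \<phi> w powr (1 - p) * (C\<^sub>2 * (\<phi> w powr (p - 1) * \<sigma> w))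
        = C\<^sub>2 * (g w powr p * \<sigma> w) * (\<phi> w powr (1 - p) * \<phi> w powr (p - 1))"
      by (simp add: mult_ac)
    \<comment> \<open>The power of \<phi> produced by the splitting cancels the one from the second
      Schur hypothesis, so only g^p times the weight \<open>\<sigma>\<close> survives.\<close>
    also have "\<phi> w powr (1 - p) * \<phi> w powr (p - 1) = 1"
      using \<phi>[OF w] by (simp flip: powr_add)
    finally show "(\<integral>\<^sup>+z. ennreal (\<Psi> z powr (p - 1)) * (k z w * ?G w) \<partial>M)
        \<le> ennreal C\<^sub>2 * ennreal (g w powr p * \<sigma> w)"
      using C by (simp add: ennreal_mult')
  qed
  also have "\<dots> = ennreal C\<^sub>2 * (\<integral>\<^sup>+w. ennreal (g w powr p * \<sigma> w) \<partial>N)"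
    by (rule nn_integral_cmult) simp
  finally have "emeasure M {z \<in> space M. ennreal lam < (\<integral>\<^sup>+w. k z w * ennreal (g w) \<partial>N)}
    \<le> ennreal c * (ennreal C\<^sub>2 * (\<integral>\<^sup>+w. ennreal (g w powr p * \<sigma> w) \<partial>N))"
    by (simp add: mult_left_mono)
  also have "\<dots> = ennreal (2 powr p * C\<^sub>1 powr (p - 1) * C\<^sub>2 / lam powr p) * (\<integral>\<^sup>+w. ennreal (g w powr p * \<sigma> w) \<partial>N)"
    using C c0 by (simp add: c_def ennreal_mult'[symmetric] mult.assoc[symmetric])
  finally show ?thesis .
qed

section \<open>The Hartogs triangle\<close>

lemma borel_measurable_fst_borel [measurable]:
  "(fst :: 'a::topological_space \<times> 'b::topological_space \<Rightarrow> 'a) \<in> borel_measurable borel"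
  by (intro borel_measurable_continuous_onI continuous_intros)

lemma borel_measurable_snd_borel [measurable]:
  "(snd :: 'a::topological_space \<times> 'b::topological_space \<Rightarrow> 'b) \<in> borel_measurable borel"
  by (intro borel_measurable_continuous_onI continuous_intros)

lemma hartogs_borel [measurable, simp]: "hartogs \<in> sets borel"
proof -
  have "hartogs = {w. cmod (fst w) < cmod (snd w) \<and> cmod (snd w) < 1}"
    by (auto simp: hartogs_def)
  also have "\<dots> \<in> sets borel" by measurable
  finally show ?thesis .
qed

lemma borel_measurable_bergman_kernel [measurable (raw)]:
  assumes [measurable]: "f \<in> borel_measurable M" "g \<in> borel_measurable M"
  shows "(\<lambda>x. bergman_kernel (f x) (g x)) \<in> borel_measurable M"
  unfolding bergman_kernel_def by measurable

text \<open>The kernel is Hermitian: exchanging its arguments conjugates it. Thus one estimate for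
  integration in the second argument serves both Schur conditions.\<close>

lemma cmod_bergman_kernel_commute: "cmod (bergman_kernel z w) = cmod (bergman_kernel w z)"
proof -
  have 1: "cmod (1 - snd z * cnj (snd w)) = cmod (1 - snd w * cnj (snd z))"
    using complex_mod_cnj[of "1 - snd z * cnj (snd w)"] by (simp add: mult.commute)
  have 2: "cmod (1 - fst z * cnj (fst w) / (snd z * cnj (snd w))) = cmod (1 - fst w * cnj (fst z) / (snd w * cnj (snd z)))"
    using complex_mod_cnj[of "1 - fst z * cnj (fst w) / (snd z * cnj (snd w))"] by (simp add: mult.commute)
  show ?thesis
    by (simp add: bergman_kernel_def norm_divide norm_mult norm_power 1 2 mult_ac)
qed

lemma cmod_bergman_kernel_fibre:
  assumes "y \<noteq> 0"
  shows "cmod (bergman_kernel z (y * s, y)) = 1 / (pi\<^sup>2 * cmod (snd z) * cmod y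
    * (cmod (1 - fst z / snd z * cnj s))\<^sup>2 * (cmod (1 - snd z * cnj y))\<^sup>2)"
proof -
  have "fst z * cnj (y * s) / (snd z * cnj y) = fst z / snd z * cnj s"
    using assms by simp
  then show ?thesis
    by (simp add: bergman_kernel_def norm_divide norm_mult norm_power)
qed

text \<open>The coordinates \<open>(s, y) \<mapsto> (y s, y)\<close> map the product of the disc and the punctured disc onto the
  Hartogs triangle and turn the kernel into a product of two disc kernels.\<close>

lemma nn_integral_hartogs_kernel_le:
  fixes u :: "complex \<Rightarrow> real"
  assumes a: "0 < a" "a < 1" and z: "z \<in> hartogs"
    and [measurable]: "u \<in> borel_measurable borel" and u: "\<And>y. u y \<ge> 0"
  shows "(\<integral>\<^sup>+w. ennreal (cmod (bergman_kernel z w))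
      * ennreal ((1 - (cmod (fst w / snd w))\<^sup>2) powr (-a) * u (snd w)) * indicator hartogs w \<partial>lborel)
    \<le> ennreal ((1 / a + 1 / (1 - a)) / pi * (1 - (cmod (fst z / snd z))\<^sup>2) powr (-a) / cmod (snd z))
      * (\<integral>\<^sup>+y. ennreal (cmod y * u y / (cmod (1 - snd z * cnj y))\<^sup>2) * indicator (ball 0 1) y \<partial>lborel)"
proof -
  let ?t = "fst z / snd z"
  let ?P = "(1 - (cmod ?t)\<^sup>2) powr (-a)"
  let ?c = "1 / a + 1 / (1 - a)"
  let ?h = "\<lambda>y. ennreal (cmod y * u y / (cmod (1 - snd z * cnj y))\<^sup>2) * indicator (ball 0 1) y"
  define f where "f = (\<lambda>w. ennreal (cmod (bergman_kernel z w))
      * ennreal ((1 - (cmod (fst w / snd w))\<^sup>2) powr (-a) * u (snd w)) * indicator hartogs w)"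
  have f[measurable]: "f \<in> borel_measurable borel"
    unfolding f_def by measurable
  then have f': "f \<in> borel_measurable (lborel \<Otimes>\<^sub>M lborel)"
    by (simp add: lborel_prod)
  have [measurable]: "(\<lambda>x. f (x, y)) \<in> borel_measurable borel" for y
    by (intro measurable_compose[OF _ f] borel_measurable_continuous_onI continuous_intros)
  have z0: "snd z \<noteq> 0" and t: "cmod ?t < 1"
    using z by (auto simp: hartogs_def norm_divide divide_simps)
  have "(\<integral>\<^sup>+w. f w \<partial>lborel) = (\<integral>\<^sup>+y. (\<integral>\<^sup>+x. f (x, y) \<partial>lborel) \<partial>lborel)"
    using lborel_pair.nn_integral_snd[OF f'] by (simp add: lborel_prod)
  also have "\<dots> \<le> (\<integral>\<^sup>+y. ennreal (?c / pi * ?P / cmod (snd z)) * ?h y \<partial>lborel)"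
  proof (rule nn_integral_mono)
    fix y :: complex
    show "(\<integral>\<^sup>+x. f (x, y) \<partial>lborel) \<le> ennreal (?c / pi * ?P / cmod (snd z)) * ?h y"
    proof (cases "y \<noteq> 0 \<and> cmod y < 1")
      case False
      then have "f (x, y) = 0" for x
        by (auto simp: f_def hartogs_def)
      then show ?thesis by simp
    next
      case True
      then have y: "y \<noteq> 0" "cmod y < 1" by auto
      \<comment> \<open>\<open>?q\<close> collects what is constant along the fibre. Its 1/|y| meets
        the Jacobian |y|^2 of x = y s, and this leaves the factor \<open>cmod y\<close> in the
        remaining integral.\<close>
      let ?q = "u y / (pi\<^sup>2 * cmod (snd z) * cmod y * (cmod (1 - snd z * cnj y))\<^sup>2)"
      have q: "?q \<ge> 0" using u by simp
      have "(\<integral>\<^sup>+x. f (x, y) \<partial>lborel)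
          = ennreal ((cmod y)\<^sup>2) * (ennreal (1 / (cmod y)\<^sup>2) * (\<integral>\<^sup>+x. f (x, y) \<partial>lborel))"
        using y by (simp add: mult.assoc[symmetric] ennreal_mult'[symmetric])
      also have "\<dots> = ennreal ((cmod y)\<^sup>2) * (\<integral>\<^sup>+s. f (y * s, y) \<partial>lborel)"
        using nn_integral_lborel_complex_mult[of "\<lambda>x. f (x, y)" y] y by simp
      also have "(\<integral>\<^sup>+s. f (y * s, y) \<partial>lborel) = (\<integral>\<^sup>+s. ennreal ?q
          * (ennreal ((1 - (cmod s)\<^sup>2) powr (-a) / (cmod (1 - ?t * cnj s))\<^sup>2) * indicator (ball 0 1) s) \<partial>lborel)"
      proof (rule nn_integral_cong)
        fix s :: complex
        have "(y * s, y) \<in> hartogs \<longleftrightarrow> s \<in> ball 0 1"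
          using y by (auto simp: hartogs_def norm_mult)
        moreover have "cmod (bergman_kernel z (y * s, y)) * ((1 - (cmod (y * s / y))\<^sup>2) powr (-a) * u y)
            = ?q * ((1 - (cmod s)\<^sup>2) powr (-a) / (cmod (1 - ?t * cnj s))\<^sup>2)"
          using y by (simp add: cmod_bergman_kernel_fibre) (simp add: mult_ac)
        ultimately show "f (y * s, y) = ennreal ?q
            * (ennreal ((1 - (cmod s)\<^sup>2) powr (-a) / (cmod (1 - ?t * cnj s))\<^sup>2) * indicator (ball 0 1) s)"
          unfolding f_def fst_conv snd_conv indicator_def
          by (simp only: ennreal_mult'[symmetric] norm_ge_zero q mult.assoc[symmetric])
      qed
      also have "\<dots> = ennreal ?q
          * (\<integral>\<^sup>+s. ennreal ((1 - (cmod s)\<^sup>2) powr (-a) / (cmod (1 - ?t * cnj s))\<^sup>2) * indicator (ball 0 1) s \<partial>lborel)"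
        by (rule nn_integral_cmult) simp
      also have "\<dots> \<le> ennreal ?q * ennreal (pi * ?c * ?P)"
        by (intro mult_left_mono nn_integral_disc_kernel_powr_le a t) simp
      also have "ennreal ((cmod y)\<^sup>2) * (ennreal ?q * ennreal (pi * ?c * ?P)) = ennreal ((cmod y)\<^sup>2 * (?q * (pi * ?c * ?P)))"
        using q by (simp only: ennreal_mult'[symmetric] zero_le_power2)
      also have "(cmod y)\<^sup>2 * (?q * (pi * ?c * ?P)) = (?c / pi * ?P / cmod (snd z)) * (cmod y * u y / (cmod (1 - snd z * cnj y))\<^sup>2)"
        using y by (simp add: power2_eq_square) (simp add: mult_ac)
      also have "ennreal \<dots> = ennreal (?c / pi * ?P / cmod (snd z)) * ?h y"
        using y a by (subst ennreal_mult') auto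
      finally show ?thesis by (simp add: mult_left_mono)
    qed
  qed
  also have "\<dots> = ennreal (?c / pi * ?P / cmod (snd z)) * (\<integral>\<^sup>+y. ?h y \<partial>lborel)"
    by (rule nn_integral_cmult) simp
  finally show ?thesis by (simp add: f_def)
qed

section \<open>The two test functions and the two Schur conditions\<close>

text \<open>The exponent 1/2 is a choice: any number in (0,1) would do, as its third, which occurs
  in the dual condition, lies in (0,1) too.\<close>

definition schur_density :: "real \<Rightarrow> complex \<times> complex \<Rightarrow> real" where
  "schur_density d w = (1 - (cmod (fst w / snd w))\<^sup>2) powr (-(1/2))
    * ((1 - (cmod (snd w))\<^sup>2) powr (-(1/2)) * (1 / cmod (snd w) ^ 3) * (1 - ln (cmod (snd w))) powr (-d))"

definition schur_image :: "complex \<times> complex \<Rightarrow> real" where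
  "schur_image z = (1 - (cmod (fst z / snd z))\<^sup>2) powr (-(1/2)) * (1 - (cmod (snd z))\<^sup>2) powr (-(1/2)) / cmod (snd z)"

lemma hartogs_coordinates:
  assumes "w \<in> hartogs"
  shows "0 < cmod (snd w)" "cmod (snd w) < 1" "0 < 1 - (cmod (fst w / snd w))\<^sup>2"
    "0 < 1 - (cmod (snd w))\<^sup>2" "ln (cmod (snd w)) \<noteq> 1"
proof -
  show w: "0 < cmod (snd w)" "cmod (snd w) < 1"
    using assms by (auto simp: hartogs_def intro: le_less_trans[OF norm_ge_zero])
  have "cmod (fst w / snd w) < 1"
    using assms w by (auto simp: hartogs_def norm_divide)
  then show "0 < 1 - (cmod (fst w / snd w))\<^sup>2"
    by (simp add: abs_square_less_1)
  show "0 < 1 - (cmod (snd w))\<^sup>2"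
    using w by (simp add: abs_square_less_1)
  show "ln (cmod (snd w)) \<noteq> 1"
    using w ln_less_zero[of "cmod (snd w)"] by linarith
qed

lemma schur_density_pos: "w \<in> hartogs \<Longrightarrow> schur_density d w > 0"
  unfolding schur_density_def using hartogs_coordinates[of w]
  by (intro mult_pos_pos divide_pos_pos zero_less_power powr_gt_zero[THEN iffD2]) auto

lemma schur_image_pos: "w \<in> hartogs \<Longrightarrow> schur_image w > 0"
  unfolding schur_image_def using hartogs_coordinates[of w]
  by (intro mult_pos_pos divide_pos_pos powr_gt_zero[THEN iffD2]) auto

lemma borel_measurable_schur_density [measurable]: "schur_density d \<in> borel_measurable borel"
  unfolding schur_density_def by measurable

lemma borel_measurable_schur_image [measurable]: "schur_image \<in> borel_measurable borel"
  unfolding schur_image_def by measurable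

text \<open>Direct Schur condition. The fibre estimate at a = 1/2 settles the first coordinate; in
  the second, |y| times |y|^(-3) is the critical |y|^(-2), tamed by the logarithm with d >
  1.\<close>

lemma nn_integral_schur_density_le:
  assumes d: "d > 1"
  shows "\<exists>C>0. \<forall>z\<in>hartogs. (\<integral>\<^sup>+w. ennreal (cmod (bergman_kernel z w)) * ennreal (schur_density d w) * indicator hartogs w \<partial>lborel)
    \<le> ennreal (C * schur_image z)"
proof -
  let ?u = "\<lambda>y. (1 - (cmod y)\<^sup>2) powr (-(1/2)) * (1 / cmod y ^ 3) * (1 - ln (cmod y)) powr (-d)"
  let ?c = "(1 / (1/2) + 1 / (1 - 1/2)) :: real"
  define K where "K = 4 * (pi * ?c) + 8 * (pi * (2 / (d - 1)))"
  have K: "K > 0" using d by (auto simp: K_def intro!: add_pos_pos)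
  have "(\<integral>\<^sup>+w. ennreal (cmod (bergman_kernel z w)) * ennreal (schur_density d w) * indicator hartogs w \<partial>lborel)
    \<le> ennreal (?c / pi * K * schur_image z)" if z: "z \<in> hartogs" for z
  proof -
    let ?r = "1 - (cmod (fst z / snd z))\<^sup>2"
    have "(\<integral>\<^sup>+w. ennreal (cmod (bergman_kernel z w)) * ennreal (schur_density d w) * indicator hartogs w \<partial>lborel)
      \<le> ennreal (?c / pi * ?r powr (-(1/2)) / cmod (snd z))
        * (\<integral>\<^sup>+y. ennreal (cmod y * ?u y / (cmod (1 - snd z * cnj y))\<^sup>2) * indicator (ball 0 1) y \<partial>lborel)"
      unfolding schur_density_def by (rule nn_integral_hartogs_kernel_le) (use z in auto)
    also have "(\<integral>\<^sup>+y. ennreal (cmod y * ?u y / (cmod (1 - snd z * cnj y))\<^sup>2) * indicator (ball 0 1) y \<partial>lborel)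
      = (\<integral>\<^sup>+y. ennreal (1 / (cmod y)\<^sup>2 * (1 - ln (cmod y)) powr (-d) * (1 - (cmod y)\<^sup>2) powr (-(1/2))
          / (cmod (1 - snd z * cnj y))\<^sup>2) * indicator (ball 0 1) y \<partial>lborel)"
    proof (rule nn_integral_cong)
      fix y
      have "cmod y * ?u y = cmod y * (1 / cmod y ^ 3) * (1 - ln (cmod y)) powr (-d) * (1 - (cmod y)\<^sup>2) powr (-(1/2))"
        by (simp only: mult_ac)
      also have "cmod y * (1 / cmod y ^ 3) = 1 / (cmod y)\<^sup>2"
        by (simp add: power2_eq_square power3_eq_cube)
      finally show "ennreal (cmod y * ?u y / (cmod (1 - snd z * cnj y))\<^sup>2) * indicator (ball 0 1) y
        = ennreal (1 / (cmod y)\<^sup>2 * (1 - ln (cmod y)) powr (-d) * (1 - (cmod y)\<^sup>2) powr (-(1/2))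
          / (cmod (1 - snd z * cnj y))\<^sup>2) * indicator (ball 0 1) y"
        by (simp only:)
    qed
    also have "\<dots> \<le> ennreal (K * (1 - (cmod (snd z))\<^sup>2) powr (-(1/2)))"
      unfolding K_def by (rule nn_integral_disc_kernel_log_le) (use d hartogs_coordinates[OF z] in auto)
    also have "ennreal (?c / pi * ?r powr (-(1/2)) / cmod (snd z)) * ennreal (K * (1 - (cmod (snd z))\<^sup>2) powr (-(1/2)))
      = ennreal (?c / pi * K * schur_image z)"
      by (subst ennreal_mult'[symmetric]) (simp_all add: schur_image_def mult_ac)
    finally show ?thesis by (simp add: mult_left_mono)
  qed
  moreover have "?c / pi * K > 0" using K by simp
  ultimately show ?thesis by blast
qed

text \<open>Dual Schur condition, with p - 1 = 1/3: cube roots turn the exponents 1/2 into 1/6 and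
  1/|z_2| into |z_2|^(-1/3). The origin is harmless here, because |y| times |y|^(-1/3) is at most 1
  on the disc.\<close>

lemma nn_integral_schur_image_le:
  "\<exists>C\<ge>0. \<forall>w\<in>hartogs. (\<integral>\<^sup>+z. ennreal (cmod (bergman_kernel z w)) * ennreal (schur_image z powr (1/3)) * indicator hartogs z \<partial>lborel)
    \<le> ennreal (C * (schur_density (3 * eps) w powr (1/3) * hweight eps w))"
proof -
  let ?u = "\<lambda>y. (1 - (cmod y)\<^sup>2) powr (-(1/6)) * cmod y powr (-(1/3))"
  let ?c = "(1 / (1/6) + 1 / (1 - 1/6)) :: real"
  define K where "K = ?c / pi * (pi * ?c)"
  have "(\<integral>\<^sup>+z. ennreal (cmod (bergman_kernel z w)) * ennreal (schur_image z powr (1/3)) * indicator hartogs z \<partial>lborel)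
    \<le> ennreal (K * (schur_density (3 * eps) w powr (1/3) * hweight eps w))" if w: "w \<in> hartogs" for w
  proof -
    let ?r = "1 - (cmod (fst w / snd w))\<^sup>2"
    let ?s = "1 - (cmod (snd w))\<^sup>2"
    note w' = hartogs_coordinates[OF w]
    have "(\<integral>\<^sup>+z. ennreal (cmod (bergman_kernel z w)) * ennreal (schur_image z powr (1/3)) * indicator hartogs z \<partial>lborel)
      = (\<integral>\<^sup>+z. ennreal (cmod (bergman_kernel w z))
          * ennreal ((1 - (cmod (fst z / snd z))\<^sup>2) powr (-(1/6)) * ?u (snd z)) * indicator hartogs z \<partial>lborel)"
    proof (rule nn_integral_cong)
      fix z
      have "schur_image z powr (1/3) = (1 - (cmod (fst z / snd z))\<^sup>2) powr (-(1/6)) * ?u (snd z)" if "z \<in> hartogs"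
        using hartogs_coordinates[OF that]
        by (simp add: schur_image_def powr_mult powr_divide powr_powr powr_minus_divide)
      then show "ennreal (cmod (bergman_kernel z w)) * ennreal (schur_image z powr (1/3)) * indicator hartogs z
        = ennreal (cmod (bergman_kernel w z))
          * ennreal ((1 - (cmod (fst z / snd z))\<^sup>2) powr (-(1/6)) * ?u (snd z)) * indicator hartogs z"
        by (cases "z \<in> hartogs") (simp_all only: cmod_bergman_kernel_commute[of z w] indicator_simps
            mult_zero_right not_False_eq_True)
    qed
    also have "\<dots> \<le> ennreal (?c / pi * ?r powr (-(1/6)) / cmod (snd w))
        * (\<integral>\<^sup>+y. ennreal (cmod y * ?u y / (cmod (1 - snd w * cnj y))\<^sup>2) * indicator (ball 0 1) y \<partial>lborel)"
      by (rule nn_integral_hartogs_kernel_le) (use w in auto)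
    also have "(\<integral>\<^sup>+y. ennreal (cmod y * ?u y / (cmod (1 - snd w * cnj y))\<^sup>2) * indicator (ball 0 1) y \<partial>lborel)
      \<le> (\<integral>\<^sup>+y. ennreal ((1 - (cmod y)\<^sup>2) powr (-(1/6)) / (cmod (1 - snd w * cnj y))\<^sup>2) * indicator (ball 0 1) y \<partial>lborel)"
    proof (rule nn_integral_mono)
      fix y
      show "ennreal (cmod y * ?u y / (cmod (1 - snd w * cnj y))\<^sup>2) * indicator (ball 0 1) y
        \<le> ennreal ((1 - (cmod y)\<^sup>2) powr (-(1/6)) / (cmod (1 - snd w * cnj y))\<^sup>2) * indicator (ball 0 1) y"
      proof (cases "y \<in> ball 0 1")
        case True
        have "cmod y * cmod y powr (-(1/3)) \<le> 1"
        proof (cases "y = 0")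
          case False
          then have "cmod y * cmod y powr (-(1/3)) = cmod y powr (2/3)"
            using powr_add[of "cmod y" 1 "-(1/3)"] by simp
          also have "\<dots> \<le> 1" using True by (intro powr_le1) auto
          finally show ?thesis .
        qed simp
        then have "(1 - (cmod y)\<^sup>2) powr (-(1/6)) * (cmod y * cmod y powr (-(1/3))) \<le> (1 - (cmod y)\<^sup>2) powr (-(1/6)) * 1"
          by (intro mult_left_mono) auto
        then have "cmod y * ?u y \<le> (1 - (cmod y)\<^sup>2) powr (-(1/6))"
          by (simp add: mult_ac)
        then show ?thesis
          by (intro mult_right_mono ennreal_leI divide_right_mono) auto
      qed simp
    qed
    also have "\<dots> \<le> ennreal (pi * ?c * ?s powr (-(1/6)))"
      by (rule nn_integral_disc_kernel_powr_le) (use w' in auto)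
    also have "ennreal (?c / pi * ?r powr (-(1/6)) / cmod (snd w)) * ennreal (pi * ?c * ?s powr (-(1/6)))
      = ennreal (?c / pi * ?r powr (-(1/6)) / cmod (snd w) * (pi * ?c * ?s powr (-(1/6))))"
      by (rule ennreal_mult'[symmetric]) simp
    \<comment> \<open>The factor 3 in \<open>3 * eps\<close> pays off: the cube root of the density
      carries the logarithm to the power -eps, which \<open>hweight\<close> cancels, and |w_2|^(-3)
      becomes the kernel factor 1/|w_2|.\<close>
    also have "?c / pi * ?r powr (-(1/6)) / cmod (snd w) * (pi * ?c * ?s powr (-(1/6)))
      = K * (schur_density (3 * eps) w powr (1/3) * hweight eps w)"
    proof -
      have "(cmod (snd w) ^ 3) powr (1/3) = cmod (snd w)"
        using w' by (simp add: powr_powr flip: powr_numeral)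
      moreover have "(1 - ln (cmod (snd w))) powr (-eps) * (1 - ln (cmod (snd w))) powr eps = 1"
        using w' by (simp flip: powr_add)
      moreover have "schur_density (3 * eps) w powr (1/3)
        = ?r powr (-(1/6)) * (?s powr (-(1/6)) * (1 / (cmod (snd w) ^ 3) powr (1/3)) * (1 - ln (cmod (snd w))) powr (-eps))"
        using w' by (simp add: schur_density_def powr_mult powr_divide powr_powr)
      ultimately show ?thesis
        by (simp add: hweight_def K_def mult.assoc)
    qed
    finally show ?thesis by (simp add: mult_left_mono)
  qed
  moreover have "K \<ge> 0" by (simp add: K_def)
  ultimately show ?thesis by blast
qed

section \<open>From the projection to the positive operator\<close>

text \<open>Where the integrand is not integrable the Bochner integral is 0 by convention and the
  bound is trivial, so convergence of the projection integral never has to be established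
  separately.\<close>

lemma cmod_bergman_proj_le:
  "ennreal (cmod (bergman_proj f z))
    \<le> (\<integral>\<^sup>+w. ennreal (cmod (bergman_kernel z w)) * ennreal (cmod (f w)) \<partial>lebesgue_on hartogs)"
proof (cases "integrable (lebesgue_on hartogs) (\<lambda>w. bergman_kernel z w * f w)")
  case True
  from integral_norm_bound_ennreal[OF True] show ?thesis
    by (simp add: bergman_proj_def norm_mult ennreal_mult)
qed (simp add: bergman_proj_def not_integrable_integral_eq)

text \<open>The function f is only Lebesgue measurable, while the Schur test exchanges integrals
  over a product of Borel-based measures. Since F is arbitrary, a single Borel representative of |f|
  serves both the weighted norm and the kernel integrals at every z.\<close>

lemma borel_representative_lebesgue_on:
  fixes f :: "'a::euclidean_space \<Rightarrow> 'b::{real_normed_vector, second_countable_topology}"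
  assumes f: "f \<in> borel_measurable (lebesgue_on S)" and S: "S \<in> sets borel"
  obtains g :: "'a \<Rightarrow> real" where "g \<in> borel_measurable borel" "\<And>x. g x \<ge> 0"
    "\<And>F. (\<integral>\<^sup>+x. F x (norm (f x)) \<partial>lebesgue_on S) = (\<integral>\<^sup>+x. F x (g x) \<partial>restrict_space lborel S)"
proof -
  have "(\<lambda>x. norm (f x)) \<in> borel_measurable (restrict_space lebesgue S)"
    using f by simp
  then have "(\<lambda>x. norm (f x) * indicator S x) \<in> borel_measurable lebesgue"
    using S by (subst (asm) borel_measurable_restrict_space_iff) (auto simp: mult.commute)
  from completion_ex_borel_measurable_real[OF this]
  obtain g where g: "g \<in> borel_measurable lborel" "AE x in lborel. norm (f x) * indicator S x = g x"
    by blast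
  show ?thesis
  proof (rule that[of "\<lambda>x. \<bar>g x\<bar>"])
    show "(\<lambda>x. \<bar>g x\<bar>) \<in> borel_measurable borel" using g(1) by simp
    fix F :: "'a \<Rightarrow> real \<Rightarrow> ennreal"
    have "(\<integral>\<^sup>+x. F x (norm (f x)) \<partial>lebesgue_on S) = (\<integral>\<^sup>+x. F x (norm (f x)) * indicator S x \<partial>lborel)"
      using S by (simp add: nn_integral_restrict_space nn_integral_completion)
    also have "\<dots> = (\<integral>\<^sup>+x. F x \<bar>g x\<bar> * indicator S x \<partial>lborel)"
    proof (rule nn_integral_cong_AE)
      show "AE x in lborel. F x (norm (f x)) * indicator S x = F x \<bar>g x\<bar> * indicator S x"
        using g(2) by eventually_elim (auto simp: indicator_def, metis abs_norm_cancel)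
    qed
    also have "\<dots> = (\<integral>\<^sup>+x. F x \<bar>g x\<bar> \<partial>restrict_space lborel S)"
      using S by (simp add: nn_integral_restrict_space)
    finally show "(\<integral>\<^sup>+x. F x (norm (f x)) \<partial>lebesgue_on S) = (\<integral>\<^sup>+x. F x \<bar>g x\<bar> \<partial>restrict_space lborel S)" .
  qed simp
qed

theorem theorem4p7:
  fixes eps :: real
  assumes "eps > 1/3"
  shows "\<exists>C>0. \<forall>(f :: complex \<times> complex \<Rightarrow> complex) (lam :: real). in_wLp (4/3) (hweight eps) f \<and> lam > 0 \<longrightarrow>
           emeasure lebesgue {z \<in> hartogs. cmod (bergman_proj f z) > lam}
             \<le> ennreal (C / lam powr (4/3)) * wLp_pow (4/3) (hweight eps) f"
proof -
  define H where "H = restrict_space lborel hartogs"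
  have space_H: "space H = hartogs" by (simp add: H_def space_restrict_space)
  have sf: "sigma_finite_measure H"
    unfolding H_def by (rule sigma_finite_measure_restrict_space[OF sigma_finite_lborel]) simp
  have H_id: "(\<lambda>x. x) \<in> measurable H borel"
    unfolding H_def by (rule measurable_restrict_space1) simp
  have meas: "F \<in> borel_measurable H" if "F \<in> borel_measurable borel" for F :: "complex \<times> complex \<Rightarrow> real"
    using measurable_compose[OF H_id that] .
  have nn_H: "(\<integral>\<^sup>+x. F x \<partial>H) = (\<integral>\<^sup>+x. F x * indicator hartogs x \<partial>lborel)" for F
    unfolding H_def by (simp add: nn_integral_restrict_space)
  have [measurable]: "(\<lambda>x. fst x) \<in> borel_measurable (H \<Otimes>\<^sub>M H)" "(\<lambda>x. snd x) \<in> borel_measurable (H \<Otimes>\<^sub>M H)"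
    using measurable_compose[OF measurable_fst H_id] measurable_compose[OF measurable_snd H_id] by auto
  have ker: "(\<lambda>(z, w). ennreal (cmod (bergman_kernel z w))) \<in> borel_measurable (H \<Otimes>\<^sub>M H)"
    unfolding case_prod_beta by measurable
  obtain C1 where C1: "C1 > 0" and S1: "\<And>z. z \<in> hartogs \<Longrightarrow>
      (\<integral>\<^sup>+w. ennreal (cmod (bergman_kernel z w)) * ennreal (schur_density (3 * eps) w) \<partial>H) \<le> ennreal (C1 * schur_image z)"
    using nn_integral_schur_density_le[of "3 * eps"] assms unfolding nn_H by auto
  obtain C2 where C2: "C2 \<ge> 0" and S2: "\<And>w. w \<in> hartogs \<Longrightarrow>
      (\<integral>\<^sup>+z. ennreal (cmod (bergman_kernel z w)) * ennreal (schur_image z powr (4/3 - 1)) \<partial>H)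
        \<le> ennreal (C2 * (schur_density (3 * eps) w powr (4/3 - 1) * hweight eps w))"
    using nn_integral_schur_image_le[of eps] unfolding nn_H by auto
  define C where "C = 2 powr (4/3) * C1 powr (4/3 - 1) * C2"
  have C: "C \<ge> 0" using C2 by (simp add: C_def)
  have weight: "hweight eps \<in> borel_measurable borel"
    unfolding hweight_def by measurable
  show ?thesis
  \<comment> \<open>\<open>C2\<close>, and with it \<open>C\<close>, is only known to be
    nonnegative; adding 1 makes the constant positive.\<close>
  proof (intro exI[of _ "C + 1"] conjI allI impI)
    show "C + 1 > 0" using C by simp
  next
    fix f :: "complex \<times> complex \<Rightarrow> complex" and lam :: real
    assume "in_wLp (4/3) (hweight eps) f \<and> lam > 0"
    then have f: "f \<in> borel_measurable (lebesgue_on hartogs)" and lam: "lam > 0"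
      by (auto simp: in_wLp_def)
    from borel_representative_lebesgue_on[OF f hartogs_borel]
    obtain g where g: "g \<in> borel_measurable borel" "\<And>x. g x \<ge> 0"
      and fg: "\<And>F. (\<integral>\<^sup>+x. F x (cmod (f x)) \<partial>lebesgue_on hartogs) = (\<integral>\<^sup>+x. F x (g x) \<partial>H)"
      unfolding H_def by blast
    let ?S = "{z \<in> space H. ennreal lam < (\<integral>\<^sup>+w. ennreal (cmod (bergman_kernel z w)) * ennreal (g w) \<partial>H)}"
    interpret H: sigma_finite_measure H by fact
    have [measurable]: "g \<in> borel_measurable H" by (rule meas[OF g(1)])
    have "(\<lambda>z. \<integral>\<^sup>+w. ennreal (cmod (bergman_kernel z w)) * ennreal (g w) \<partial>H) \<in> borel_measurable H"
      using ker by (intro H.borel_measurable_nn_integral) (simp add: case_prod_beta)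
    then have S: "?S \<in> sets H"
      by measurable
    then have S': "?S \<in> sets lborel"
      unfolding H_def by (subst (asm) sets_restrict_space_iff) (auto simp: space_restrict_space)
    have "emeasure lebesgue {z \<in> hartogs. cmod (bergman_proj f z) > lam} \<le> emeasure lebesgue ?S"
    \<comment> \<open>Monotonicity asks for measurability of the larger set alone, so the superlevel
      set of the projection itself need not be shown measurable.\<close>
    proof (rule emeasure_mono)
      have "ennreal lam < (\<integral>\<^sup>+w. ennreal (cmod (bergman_kernel z w)) * ennreal (g w) \<partial>H)"
        if "cmod (bergman_proj f z) > lam" for z
        using cmod_bergman_proj_le[of f z] that lam
        unfolding fg[of "\<lambda>w r. ennreal (cmod (bergman_kernel z w)) * ennreal r"]
        by (meson ennreal_lessI less_le_trans order.strict_trans)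
      then show "{z \<in> hartogs. cmod (bergman_proj f z) > lam} \<subseteq> ?S"
        by (auto simp: space_H)
      show "?S \<in> sets lebesgue" using S' by (rule sets_completionI_sets)
    qed
    also have "\<dots> = emeasure lborel ?S"
      using S' by simp
    also have "\<dots> = emeasure H ?S"
      unfolding H_def by (subst emeasure_restrict_space) (auto simp: space_restrict_space)
    also have "\<dots> \<le> ennreal (C / lam powr (4/3)) * (\<integral>\<^sup>+w. ennreal (g w powr (4/3) * hweight eps w) \<partial>H)"
      unfolding C_def
    proof (rule weak_type_schur_test[OF sf sf ker meas meas meas meas _ C1 C2 lam])
      show "schur_density (3 * eps) w > 0" if "w \<in> space H" for w
        using that by (simp only: space_H schur_density_pos)
      show "schur_image z > 0" if "z \<in> space H" for z
        using that by (simp only: space_H schur_image_pos)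
    qed (fact borel_measurable_schur_density borel_measurable_schur_image weight g
          S1[folded space_H] S2[folded space_H] | simp add: g)+
    also have "(\<integral>\<^sup>+w. ennreal (g w powr (4/3) * hweight eps w) \<partial>H) = wLp_pow (4/3) (hweight eps) f"
      unfolding wLp_pow_def fg[of "\<lambda>w r. ennreal (r powr (4/3) * hweight eps w)"] ..
    also have "ennreal (C / lam powr (4/3)) * \<dots> \<le> ennreal ((C + 1) / lam powr (4/3)) * \<dots>"
      by (intro mult_right_mono ennreal_leI divide_right_mono) auto
    finally show "emeasure lebesgue {z \<in> hartogs. cmod (bergman_proj f z) > lam}
      \<le> ennreal ((C + 1) / lam powr (4/3)) * wLp_pow (4/3) (hweight eps) f" .
  qed
qed

end
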